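(* Let $X$ be a metric space that admits a consistent, conical bicombing $\sigma$. Assume that $c\colon[0,1]\to X$ is a constant speed geodesic such that locally it is a $\sigma$-geodesic, i.e. there exists an open cover $\mathcal U$ of $[0,1]$ such that $\operatorname{im}\sigma_{c(s)c(t)}=\operatorname{im}c|_{[s,t]}$ for all $U\in\mathcal U$ and all $s,t\in U$ satisfying $s\le t$. Then $c$ is the $\sigma$-geodesic $\sigma_{c(0)c(1)}$.
   Context: A (geodesic) bicombing on a geodesic metric space $(X,d)$ is a continuous map $\sigma\colon X\times X\times[0,1]\to X$ such that each $\sigma_{xy}:=\sigma(x,y,\cdot)$ is a constant speed geodesic from $x$ to $y$; the maps $\sigma_{xy}$ are called $\sigma$-geodesics. It is consistent if $\operatorname{im}\sigma_{\sigma_{xy}(s),\sigma_{xy}(t)}=\operatorname{im}\sigma_{xy}|_{[s,t]}$ for all $x,y\in X$ and $0\le s<t\le1$; conical if $d(\sigma_{xy}(t),\sigma_{x'y'}(t))\le(1-t)d(x,x')+t\,d(y,y')$ for all $x,y,x',y'\in X$, $t\in[0,1]$. *)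

theory Defs
  imports "HOL-Analysis.Analysis"
begin

text \<open>Maps on [0,1] are represented by total functions on the reals; only their values
  on the closed unit interval are ever constrained.\<close>

definition constant_speed_geodesic :: "(real \<Rightarrow> 'a::metric_space) \<Rightarrow> bool" where
  "constant_speed_geodesic c \<longleftrightarrow>
     (\<exists>v\<ge>0. \<forall>s\<in>{0..1}. \<forall>t\<in>{0..1}. dist (c s) (c t) = v * \<bar>s - t\<bar>)"

text \<open>That the underlying space is geodesic is not a separate requirement: it follows from
  the existence of the geodesics below.\<close>

definition geodesic_bicombing :: "('a::metric_space \<Rightarrow> 'a \<Rightarrow> real \<Rightarrow> 'a) \<Rightarrow> bool" where
  "geodesic_bicombing \<sigma> \<longleftrightarrow>
     continuous_on (UNIV \<times> UNIV \<times> {0..1}) (\<lambda>(x, y, t). \<sigma> x y t) \<and>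
     (\<forall>x y. constant_speed_geodesic (\<sigma> x y) \<and> \<sigma> x y 0 = x \<and> \<sigma> x y 1 = y)"

definition consistent_bicombing :: "('a::metric_space \<Rightarrow> 'a \<Rightarrow> real \<Rightarrow> 'a) \<Rightarrow> bool" where
  "consistent_bicombing \<sigma> \<longleftrightarrow>
     (\<forall>x y s t. 0 \<le> s \<and> s < t \<and> t \<le> 1 \<longrightarrow>
        \<sigma> (\<sigma> x y s) (\<sigma> x y t) ` {0..1} = \<sigma> x y ` {s..t})"

definition conical_bicombing :: "('a::metric_space \<Rightarrow> 'a \<Rightarrow> real \<Rightarrow> 'a) \<Rightarrow> bool" where
  "conical_bicombing \<sigma> \<longleftrightarrow>
     (\<forall>x y x' y'. \<forall>t\<in>{0..1}.
        dist (\<sigma> x y t) (\<sigma> x' y' t) \<le> (1 - t) * dist x x' + t * dist y y')"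

definition locally_sigma_geodesic ::
  "('a::metric_space \<Rightarrow> 'a \<Rightarrow> real \<Rightarrow> 'a) \<Rightarrow> (real \<Rightarrow> 'a) \<Rightarrow> bool" where
  "locally_sigma_geodesic \<sigma> c \<longleftrightarrow>
     (\<exists>\<U>. (\<forall>U\<in>\<U>. openin (top_of_set {0..1}) U) \<and> \<Union>\<U> = {0..1} \<and>
        (\<forall>U\<in>\<U>. \<forall>s\<in>U. \<forall>t\<in>U. s \<le> t \<longrightarrow> \<sigma> (c s) (c t) ` {0..1} = c ` {s..t}))"

end

theory Submission
  imports Defs
begin

text \<open>Consistency and conicality make \<open>f t = dist (c t) (\<sigma> (c 0) (c 1) t)\<close> locally midpoint
  convex, because both curves restrict to reparametrised \<open>\<sigma>\<close>-geodesics on short intervals. A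
  continuous such function attains its maximum over the unit interval at an endpoint, where \<open>f\<close>
  vanishes: at the first interior maximum point the midpoint inequality would be violated.\<close>

text \<open>A point on a constant speed geodesic is determined by its distance from the start.
  Comparing the full lengths gives \<open>w = v * (t - s)\<close>; comparing the distances from the
  common start to \<open>g r = h a\<close> then fixes the parameter \<open>a\<close>, as far as
  \<open>h\<close> can distinguish parameters.\<close>

lemma constant_speed_same_image:
  fixes g h :: "real \<Rightarrow> 'a::metric_space"
  assumes g: "constant_speed_geodesic g" and h: "constant_speed_geodesic h"
    and st: "0 \<le> s" "s \<le> t" "t \<le> 1"
    and im: "g ` {0..1} = h ` {s..t}" and "g 0 = h s" "g 1 = h t"
    and r: "r \<in> {0..1}"
  shows "g r = h (s + r * (t - s))"
proof -
  obtain w where w: "\<And>a b. a \<in> {0..1} \<Longrightarrow> b \<in> {0..1} \<Longrightarrow> dist (g a) (g b) = w * \<bar>a - b\<bar>"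
    using g unfolding constant_speed_geodesic_def by blast
  obtain v where v: "\<And>a b. a \<in> {0..1} \<Longrightarrow> b \<in> {0..1} \<Longrightarrow> dist (h a) (h b) = v * \<bar>a - b\<bar>"
    using h unfolding constant_speed_geodesic_def by blast
  obtain a where a: "a \<in> {s..t}" "g r = h a"
    using im r by blast
  have "w = v * (t - s)"
    using w[of 0 1] v[of s t] st assms(7,8) by simp
  moreover have "w * r = v * (a - s)"
    using w[of 0 r] v[of s a] st r a assms(7) by simp
  \<comment> \<open>The factor \<open>v\<close> is not cancelled: it is 0 when \<open>h\<close> is
    constant. The product is, up to sign, the distance that has to vanish.\<close>
  ultimately have "v * (a - (s + r * (t - s))) = 0"
    by algebra
  moreover have "s + r * (t - s) \<in> {0..1}"
    using mult_left_le_one_le[of "t - s" r] st r by auto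
  ultimately have "dist (h a) (h (s + r * (t - s))) = 0"
    using v[of a "s + r * (t - s)"] a st by auto
  then show ?thesis using a by simp
qed

lemma constant_speed_geodesic_continuous_on:
  assumes "constant_speed_geodesic c"
  shows "continuous_on {0..1} c"
proof -
  obtain v where "v \<ge> 0" "\<And>a b. a \<in> {0..1} \<Longrightarrow> b \<in> {0..1} \<Longrightarrow> dist (c a) (c b) = v * \<bar>a - b\<bar>"
    using assms unfolding constant_speed_geodesic_def by blast
  then have "v-lipschitz_on {0..1} c"
    by (intro lipschitz_onI) (auto simp: dist_real_def)
  then show ?thesis by (rule lipschitz_on_continuous_on)
qed

text \<open>The radius \<open>e\<close> may depend on the point, with no uniform lower bound. A
  maximum argument copes with this because it uses the inequality at a single point only.\<close>

lemma locally_midpoint_convex_le_endpoints: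
  fixes f :: "real \<Rightarrow> real"
  assumes cont: "continuous_on {0..1} f"
    and mid: "\<And>t. 0 < t \<Longrightarrow> t < 1 \<Longrightarrow>
      \<exists>e>0. \<forall>d. 0 < d \<and> d < e \<and> 0 \<le> t - d \<and> t + d \<le> 1 \<longrightarrow> 2 * f t \<le> f (t - d) + f (t + d)"
    and t: "t \<in> {0..1}"
  shows "f t \<le> max (f 0) (f 1)"
proof (rule ccontr)
  assume less: "\<not> f t \<le> max (f 0) (f 1)"
  obtain m where m: "m \<in> {0..1}" "\<And>x. x \<in> {0..1} \<Longrightarrow> f x \<le> f m"
    using continuous_attains_sup[OF compact_Icc _ cont] by fastforce
  define S where "S = {x \<in> {0..1}. f x = f m}"
  have "S \<noteq> {}" using m by (auto simp: S_def)
  moreover have "compact S"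
    unfolding S_def compact_eq_bounded_closed
    using continuous_closed_preimage_constant[OF cont closed_atLeastAtMost]
    by (auto intro: bounded_subset[OF bounded_closed_interval])
  ultimately obtain p where p: "p \<in> S" "\<And>x. x \<in> S \<Longrightarrow> p \<le> x"
    using compact_attains_inf by metis
  \<comment> \<open>The maximum is at least \<open>f t\<close>, which exceeds both endpoint values
    by assumption.\<close>
  have "p \<noteq> 0" "p \<noteq> 1"
    using less m(2)[OF t] p(1) by (auto simp: S_def)
  then have p01: "0 < p" "p < 1" using p(1) by (auto simp: S_def)
  from mid[OF this] obtain e where e: "e > 0"
    "\<And>d. 0 < d \<Longrightarrow> d < e \<Longrightarrow> 0 \<le> p - d \<Longrightarrow> p + d \<le> 1 \<Longrightarrow> 2 * f p \<le> f (p - d) + f (p + d)"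
    by blast
  \<comment> \<open>Halving makes \<open>d\<close> strictly smaller than \<open>e\<close>; the other
    two bounds keep \<open>p - d\<close> and \<open>p + d\<close> in the unit interval.\<close>
  define d where "d = min (e / 2) (min p (1 - p))"
  have d: "0 < d" "d < e" "0 \<le> p - d" "p + d \<le> 1"
    using e(1) p01 by (auto simp: d_def min_def)
  \<comment> \<open>Minimality of \<open>p\<close> makes the inequality on the left strict; on the
    right the weak one suffices.\<close>
  have "p - d \<notin> S" using p(2)[of "p - d"] d by auto
  then have "f (p - d) < f m" using m(2)[of "p - d"] d p01 by (auto simp: S_def)
  moreover have "f (p + d) \<le> f m" using m(2) d p01 by auto
  moreover have "f p = f m" using p(1) by (simp add: S_def)
  ultimately show False using e(2)[OF d] by linarith
qed

theorem proposition4p6: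
  fixes \<sigma> :: "'a::metric_space \<Rightarrow> 'a \<Rightarrow> real \<Rightarrow> 'a"
    and c :: "real \<Rightarrow> 'a"
  assumes "geodesic_bicombing \<sigma>"
    and "consistent_bicombing \<sigma>"
    and "conical_bicombing \<sigma>"
    and "constant_speed_geodesic c"
    and "locally_sigma_geodesic \<sigma> c"
  shows "\<forall>t\<in>{0..1}. c t = \<sigma> (c 0) (c 1) t"
proof
  fix t :: real assume t: "t \<in> {0..1}"
  define g where "g = \<sigma> (c 0) (c 1)"
  define f where "f t = dist (c t) (g t)" for t
  have geo: "constant_speed_geodesic (\<sigma> x y)" "\<sigma> x y 0 = x" "\<sigma> x y 1 = y" for x y
    using assms(1) unfolding geodesic_bicombing_def by auto
  have g: "constant_speed_geodesic g" "g 0 = c 0" "g 1 = c 1"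
    by (simp_all add: g_def geo)
  obtain \<U> where \<U>: "\<And>U. U \<in> \<U> \<Longrightarrow> openin (top_of_set {0..1}) U" "\<Union>\<U> = {0..1}"
    "\<And>U a b. U \<in> \<U> \<Longrightarrow> a \<in> U \<Longrightarrow> b \<in> U \<Longrightarrow> a \<le> b \<Longrightarrow> \<sigma> (c a) (c b) ` {0..1} = c ` {a..b}"
    using assms(5) unfolding locally_sigma_geodesic_def by metis
  have "f t \<le> max (f 0) (f 1)"
  proof (rule locally_midpoint_convex_le_endpoints[where f = f, OF _ _ t])
    show "continuous_on {0..1} f"
      unfolding f_def
      by (rule continuous_on_dist[OF assms(4)[THEN constant_speed_geodesic_continuous_on]
            g(1)[THEN constant_speed_geodesic_continuous_on]])
  next
    fix u :: real assume u: "0 < u" "u < 1"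
    then obtain U where U: "U \<in> \<U>" "u \<in> U" using \<U>(2) by fastforce
    from \<U>(1)[OF U(1)] U(2) obtain e where e: "e > 0"
      "\<And>x. x \<in> {0..1} \<Longrightarrow> dist x u < e \<Longrightarrow> x \<in> U"
      unfolding openin_euclidean_subtopology_iff by blast
    have "2 * f u \<le> f (u - d) + f (u + d)"
      if d: "0 < d" "d < e" "0 \<le> u - d" "u + d \<le> 1" for d
    proof -
      \<comment> \<open>This is the parameter that \<open>constant_speed_same_image\<close> yields
        on \<open>{u - d..u + d}\<close> for \<open>r = 1 / 2\<close>.\<close>
      have mid: "u - d + 1 / 2 * (u + d - (u - d)) = u" by simp
      have "u - d \<in> U" "u + d \<in> U" using e(2) d u by (auto simp: dist_real_def)
      then have imc: "\<sigma> (c (u - d)) (c (u + d)) ` {0..1} = c ` {u - d..u + d}"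
        using \<U>(3)[OF U(1)] d by simp
      \<comment> \<open>For \<open>c\<close> the equality of images came from the cover and needs
        \<open>d\<close> small; for \<open>g\<close> it is consistency and holds at every
        scale.\<close>
      have img: "\<sigma> (g (u - d)) (g (u + d)) ` {0..1} = g ` {u - d..u + d}"
        unfolding g_def
        by (rule assms(2)[unfolded consistent_bicombing_def, rule_format]) (use d in simp)
      have cu: "\<sigma> (c (u - d)) (c (u + d)) (1 / 2) = c u"
        using constant_speed_same_image[OF geo(1) assms(4) d(3) _ d(4) imc, of "1 / 2"] d
        unfolding mid by (simp add: geo)
      have gu: "\<sigma> (g (u - d)) (g (u + d)) (1 / 2) = g u"
        using constant_speed_same_image[OF geo(1) g(1) d(3) _ d(4) img, of "1 / 2"] d
        unfolding mid by (simp add: geo)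
      have "dist (\<sigma> x y (1 / 2)) (\<sigma> x' y' (1 / 2))
          \<le> (1 - 1 / 2) * dist x x' + 1 / 2 * dist y y'" for x y x' y'
        by (rule assms(3)[unfolded conical_bicombing_def, rule_format]) simp
      from this[of "c (u - d)" "c (u + d)" "g (u - d)" "g (u + d)"]
      show ?thesis
        unfolding f_def cu gu by simp
    qed
    with e(1) show "\<exists>e>0. \<forall>d. 0 < d \<and> d < e \<and> 0 \<le> u - d \<and> u + d \<le> 1 \<longrightarrow>
        2 * f u \<le> f (u - d) + f (u + d)"
      by blast
  qed
  \<comment> \<open>Both endpoint values of \<open>f\<close> are 0, so the distance
    \<open>f t\<close> is at most 0.\<close>
  then show "c t = \<sigma> (c 0) (c 1) t"
    using g by (simp add: f_def g_def)
qed

end
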